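(* Let $K\ge 1$, let $S=(S_1,S_2,\dots,S_p)^\top$ be the vector of all signature components of order at most $K$ of a stochastic process $\mathbf{X}$, and assume that $S$ has a non-degenerate joint distribution. Let $L_a=\sum_{i=1}^p a_iS_i$ and $L_b=\sum_{i=1}^p b_iS_i$ be two linear combinations with real coefficients such that $a_i\ne b_i$ for at least one $i$. Put $c_i=a_i-b_i$, $C=(c_1,\dots,c_p)^\top$, $\Sigma=\mathbb{E}(SS^\top)$, and for $\theta>0$ define $$P_\theta^*(\eta)=\Bigl(1-\frac1\theta\Bigr)\cdot\frac{\dfrac{\mathbb{E}\bigl[(\sum_{i=1}^p c_iS_i)^2 \,\big|\, \|S\|_2\le\theta\sqrt{p\|\Sigma\|_2}\bigr]}{\theta\|C\|_\infty p\sqrt{\|\Sigma\|_2}}-\eta}{\theta\|C\|_\infty p\sqrt{\|\Sigma\|_2}-\eta},$$ $$\overline{\eta}=\min\left\{\frac{\mathbb{E}\bigl[(\sum_{i=1}^p c_iS_i)^2 \,\big|\, \|S\|_2\le\theta\sqrt{p\|\Sigma\|_2}\bigr]}{\theta\|C\|_\infty p\sqrt{\|\Sigma\|_2}},\ \theta\|C\|_\infty p\sqrt{\|\Sigma\|_2}\right\}.$$ Then there exists a constant $\theta>0$ such that for every $\eta\in(0,\overline\eta)$, $$\mathbb{P}(|L_a-L_b|>\eta)\ \ge\ P_\theta^*(\eta)\ >\ 0.$$ Furthermore, if $f$ is a function mapping $\mathbf{X}$ to a real value such that $|f(\mathbf{X})-L_a|\le\varepsilon$ almost surely for a constant $\varepsilon<\overline\eta$,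 then for every $\eta\in(0,\overline\eta-\varepsilon)$, $$\mathbb{P}(|f(\mathbf{X})-L_b|>\eta)\ \ge\ P_\theta^*(\eta+\varepsilon)\ >\ 0.$$
   Context: Signature: for a $d$-dimensional process $\mathbf{X}_t=(X^1_t,\dots,X^d_t)^\top$, $0\le t\le T$, the $k$-th order signature component with index $(i_1,\dots,i_k)\in\{1,\dots,d\}^k$ is the iterated integral $S(\mathbf{X})^{i_1,\dots,i_k}_t=\int_{0<t_1<\dots<t_k<t}dX^{i_1}_{t_1}\cdots dX^{i_k}_{t_k}$, defined recursively by $S(\mathbf X)^{i_1,\dots,i_k}_t=\int_0^t S(\mathbf X)^{i_1,\dots,i_{k-1}}_s\,dX^{i_k}_s$ (in the Itô or the Stratonovich sense); the $0$-th order component is the constant $1$. The signature truncated to order $K$ is the collection of all components of order $\le K$ (here evaluated at a fixed time), listed as $S_1,\dots,S_p$. Norms: for vectors $\|\cdot\|_2$ is Euclidean and $\|\cdot\|_\infty$ the maximum absolute entry; for matrices $\|A\|_2$ is the spectral norm. "Non-degenerate joint distribution" means that no non-trivial linear combination of $S_1,\dots,S_p$ vanishes almost surely. All entries of $\Sigma=\mathbb{E}(SS^\top)$ are finite. *)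

theory Defs
  imports "HOL-Probability.Probability"
begin

section \<open>Stochastic integrals and signatures\<close>

datatype integral_sense = Ito | Stratonovich

text \<open>Value of the integrand on a partition interval with end points \<open>r\<close> and \<open>s\<close>.\<close>

fun sample :: "integral_sense \<Rightarrow> (real \<Rightarrow> real) \<Rightarrow> real \<Rightarrow> real \<Rightarrow> real" where
  "sample Ito y r s = y r"
| "sample Stratonovich y r s = (y r + y s) / 2"

definition riemann_sum ::
    "integral_sense \<Rightarrow> (real \<Rightarrow> real) \<Rightarrow> (real \<Rightarrow> real) \<Rightarrow> real set set \<Rightarrow> real" where
  "riemann_sum sense y x D =
     (\<Sum>I\<in>D. sample sense y (Inf I) (Sup I) * (x (Sup I) - x (Inf I)))"

text \<open>
  \<open>J\<close> is the stochastic integral of \<open>Y\<close> against \<open>X\<close> over \<open>[0,t]\<close>: the limit in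
  probability, as the mesh tends to 0, of the left-point (Ito) or trapezoidal (Stratonovich)
  Riemann sums. This determines \<open>J\<close> almost surely. For semimartingales with continuous
  paths it is the usual integral; no semimartingale assumption is built in.
\<close>

definition has_stoch_integral ::
    "'w measure \<Rightarrow> integral_sense \<Rightarrow> (real \<Rightarrow> 'w \<Rightarrow> real) \<Rightarrow> (real \<Rightarrow> 'w \<Rightarrow> real) \<Rightarrow> real
      \<Rightarrow> ('w \<Rightarrow> real) \<Rightarrow> bool" where
  "has_stoch_integral M sense Y X t J \<longleftrightarrow>
     J \<in> borel_measurable M \<and>
     (\<forall>e>0. \<forall>\<delta>>0. \<exists>h>0. \<forall>D. D division_of {0..t} \<and> (\<forall>I\<in>D. Sup I - Inf I < h) \<longrightarrow>
        \<P>(\<omega> in M. \<bar>riemann_sum sense (\<lambda>s. Y s \<omega>) (\<lambda>s. X s \<omega>) D - J \<omega>\<bar> > e) < \<delta>)"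

text \<open>
  \<open>Sig u t\<close> is the component at time \<open>t\<close> of the signature with index the word \<open>u\<close>. The
  coordinates of the process are indexed by the finite type \<open>'d\<close>, so its dimension is
  \<open>CARD('d)\<close>. Components are specified up to order \<open>K\<close> only.
\<close>

definition is_signature ::
    "'w measure \<Rightarrow> integral_sense \<Rightarrow> real \<Rightarrow> (real \<Rightarrow> 'w \<Rightarrow> real ^ 'd) \<Rightarrow> nat
      \<Rightarrow> ('d list \<Rightarrow> real \<Rightarrow> 'w \<Rightarrow> real) \<Rightarrow> bool" where
  "is_signature M sense T X K Sig \<longleftrightarrow>
     (\<forall>t\<in>{0..T}. \<forall>\<omega>. Sig [] t \<omega> = 1) \<and>
     (\<forall>u i. length u < K \<longrightarrow>
        (\<forall>t\<in>{0..T}. has_stoch_integral M sense (Sig u) (\<lambda>s \<omega>. X s \<omega> $ i) t (Sig (u @ [i]) t)))"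

text \<open>
  The listing \<open>S\<^sub>1, \<dots>, S\<^sub>p\<close> of the components at time \<open>t\<close>, along a map
  \<open>word\<close> from the positions \<open>'n\<close> to words; \<open>p = CARD('n)\<close>.
\<close>

definition sig_vector ::
    "('d list \<Rightarrow> real \<Rightarrow> 'w \<Rightarrow> real) \<Rightarrow> ('n \<Rightarrow> 'd list) \<Rightarrow> real \<Rightarrow> 'w \<Rightarrow> real ^ 'n" where
  "sig_vector Sig word t \<omega> = (\<chi> i. Sig (word i) t \<omega>)"


section \<open>Random vectors\<close>

definition lin_comb :: "real ^ 'n \<Rightarrow> ('w \<Rightarrow> real ^ 'n) \<Rightarrow> 'w \<Rightarrow> real" where
  "lin_comb c S \<omega> = (\<Sum>i\<in>UNIV. c $ i * S \<omega> $ i)"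

definition non_degenerate :: "'w measure \<Rightarrow> ('w \<Rightarrow> real ^ 'n) \<Rightarrow> bool" where
  "non_degenerate M S \<longleftrightarrow> (\<forall>c. c \<noteq> 0 \<longrightarrow> \<not> (AE \<omega> in M. lin_comb c S \<omega> = 0))"

definition second_moment :: "'w measure \<Rightarrow> ('w \<Rightarrow> real ^ 'n) \<Rightarrow> real ^ 'n ^ 'n" where
  "second_moment M S = (\<chi> i j. \<integral>\<omega>. S \<omega> $ i * S \<omega> $ j \<partial>M)"

definition spectral_norm :: "real ^ 'n ^ 'm \<Rightarrow> real" where
  "spectral_norm A = onorm ((*v) A)"

text \<open>Expectation of \<open>Z\<close> given the event \<open>A\<close>; only meaningful if \<open>A\<close> has positive
  probability.\<close>

definition cond_expectation :: "'w measure \<Rightarrow> ('w \<Rightarrow> real) \<Rightarrow> 'w set \<Rightarrow> real" where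
  "cond_expectation M Z A = set_lebesgue_integral M A Z / measure M A"


section \<open>The quantities in the bound\<close>

definition trunc_event :: "'w measure \<Rightarrow> ('w \<Rightarrow> real ^ 'n) \<Rightarrow> real \<Rightarrow> 'w set" where
  "trunc_event M S \<theta> =
     {\<omega> \<in> space M. norm (S \<omega>) \<le> \<theta> * sqrt (CARD('n) * spectral_norm (second_moment M S))}"

definition sup_bound :: "'w measure \<Rightarrow> ('w \<Rightarrow> real ^ 'n) \<Rightarrow> real ^ 'n \<Rightarrow> real \<Rightarrow> real" where
  "sup_bound M S C \<theta> =
     \<theta> * infnorm C * CARD('n) * sqrt (spectral_norm (second_moment M S))"

definition cond_ratio :: "'w measure \<Rightarrow> ('w \<Rightarrow> real ^ 'n) \<Rightarrow> real ^ 'n \<Rightarrow> real \<Rightarrow> real" where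
  "cond_ratio M S C \<theta> =
     cond_expectation M (\<lambda>\<omega>. (lin_comb C S \<omega>)\<^sup>2) (trunc_event M S \<theta>) / sup_bound M S C \<theta>"

definition P_star ::
    "'w measure \<Rightarrow> ('w \<Rightarrow> real ^ 'n) \<Rightarrow> real ^ 'n \<Rightarrow> real \<Rightarrow> real \<Rightarrow> real" where
  "P_star M S C \<theta> \<eta> =
     (1 - 1 / \<theta>) * ((cond_ratio M S C \<theta> - \<eta>) / (sup_bound M S C \<theta> - \<eta>))"

definition eta_bar :: "'w measure \<Rightarrow> ('w \<Rightarrow> real ^ 'n) \<Rightarrow> real ^ 'n \<Rightarrow> real \<Rightarrow> real" where
  "eta_bar M S C \<theta> = min (cond_ratio M S C \<theta>) (sup_bound M S C \<theta>)"

end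

theory Submission
  imports Defs
begin

text \<open>
  On the truncation event the Cauchy--Schwarz inequality bounds \<open>Y = L\<^sub>a - L\<^sub>b\<close> by
  \<open>B = \<theta> \<parallel>C\<parallel>\<^sub>\<infinity> p \<parallel>\<Sigma>\<parallel>\<^sup>1\<^sup>/\<^sup>2\<close>, so that there
  \<open>Y\<^sup>2 \<le> B \<bar>Y\<bar> \<le> B (\<eta> + (B - \<eta>) 1{\<bar>Y\<bar> > \<eta>})\<close>. Integrating this bounds the
  probability of \<open>\<bar>Y\<bar> > \<eta>\<close> from below. The truncation event has probability at least
  \<open>1 - 1/\<theta>\<close> by Markov's inequality applied to \<open>\<parallel>S\<parallel>\<^sup>2\<close>, whose mean is the trace of \<open>\<Sigma>\<close>.
  The events exhaust the space as \<open>\<theta>\<close> grows, so by non-degeneracy \<open>Y\<close> does not vanish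
  almost surely on the event once \<open>\<theta>\<close> is large.
\<close>

section \<open>Vector and matrix inequalities\<close>

lemma lin_comb_eq_inner: "lin_comb c S \<omega> = c \<bullet> S \<omega>"
  by (simp add: lin_comb_def inner_vec_def)

lemma abs_lin_comb_le:
  fixes c :: "real ^ 'n"
  shows "\<bar>lin_comb c S \<omega>\<bar> \<le> sqrt CARD('n) * infnorm c * norm (S \<omega>)"
proof -
  have "\<bar>lin_comb c S \<omega>\<bar> \<le> norm c * norm (S \<omega>)"
    unfolding lin_comb_eq_inner by (rule Cauchy_Schwarz_ineq2)
  also have "\<dots> \<le> sqrt CARD('n) * infnorm c * norm (S \<omega>)"
    using norm_le_infnorm[of c] by (intro mult_right_mono) auto
  finally show ?thesis .
qed

text \<open>The entry is a coordinate of the image of the unit vector \<open>axis i 1\<close>. This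
  is what turns the trace of the second moment matrix into p times its spectral norm.\<close>

lemma diagonal_le_spectral_norm:
  fixes A :: "real ^ 'n ^ 'n"
  shows "A $ i $ i \<le> spectral_norm A"
proof -
  have "A $ i $ i = (A *v axis i 1) $ i"
    by (simp add: matrix_vector_mul_component inner_axis)
  also have "\<dots> \<le> norm (A *v axis i 1)"
    using component_le_norm_cart[of "A *v axis i 1" i] by linarith
  also have "\<dots> \<le> onorm ((*v) A) * norm (axis i (1::real))"
    by (intro onorm) (rule matrix_vector_mul_bounded_linear)
  finally show ?thesis by (simp add: spectral_norm_def)
qed

text \<open>Measurability is part of \<open>has_stoch_integral\<close>, so a nonempty word is
  handled by splitting off its last letter; the empty word gives the constant 1.\<close>

lemma sig_vector_measurable:
  fixes Sig :: "'d::finite list \<Rightarrow> real \<Rightarrow> 'w \<Rightarrow> real" and word :: "'n::finite \<Rightarrow> 'd list"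
  assumes sig: "is_signature M sense T X K Sig" and t: "t \<in> {0..T}"
    and len: "\<And>i. length (word i) \<le> K"
  shows "sig_vector Sig word t \<in> borel_measurable M"
proof -
  have "Sig (word i) t \<in> borel_measurable M" for i
  proof (cases "word i" rule: rev_cases)
    case Nil
    then have "Sig (word i) t = (\<lambda>_. 1)"
      using sig t by (auto simp: is_signature_def)
    then show ?thesis by simp
  next
    case (snoc u j)
    with len[of i] sig t show ?thesis
      by (auto simp: is_signature_def has_stoch_integral_def)
  qed
  then show ?thesis
    by (subst borel_measurable_euclidean_space) (auto simp: Basis_vec_def inner_axis sig_vector_def)
qed

lemma sum_square_eq_norm: "(\<Sum>i\<in>UNIV. x $ i * x $ i) = (norm (x :: real ^ 'n))\<^sup>2"
  by (simp add: power2_norm_eq_inner inner_vec_def)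

section \<open>Lower tail bounds from a truncated second moment\<close>

context prob_space
begin

text \<open>A relative of the Paley-Zygmund inequality, with a bound on \<open>A\<close> in place of
  a higher moment.\<close>

lemma prob_abs_gt_ge:
  assumes Y [measurable]: "Y \<in> borel_measurable M" and A [measurable]: "A \<in> events"
    and pos: "prob A > 0" and bound: "\<And>\<omega>. \<omega> \<in> A \<Longrightarrow> \<bar>Y \<omega>\<bar> \<le> B"
    and \<eta>: "0 \<le> \<eta>" "\<eta> < B"
  shows "prob A * ((cond_expectation M (\<lambda>\<omega>. (Y \<omega>)\<^sup>2) A / B - \<eta>) / (B - \<eta>))
           \<le> \<P>(\<omega> in M. \<bar>Y \<omega>\<bar> > \<eta>)"
proof -
  define G where "G = {\<omega> \<in> space M. \<bar>Y \<omega>\<bar> > \<eta>}"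
  define E where "E = (\<integral>\<omega>\<in>A. (Y \<omega>)\<^sup>2 \<partial>M)"
  have G [measurable]: "G \<in> events" unfolding G_def by measurable
  \<comment> \<open>\<open>G\<close> is not intersected with \<open>A\<close>, so that integration
    yields the unconditional probability. Off \<open>A\<close> the left side is 0 and the right side
    nonnegative.\<close>
  have pointwise: "indicator A \<omega> *\<^sub>R (Y \<omega>)\<^sup>2
      \<le> B * (\<eta> * indicator A \<omega> + (B - \<eta>) * indicator G \<omega>)" if "\<omega> \<in> space M" for \<omega>
  proof (cases "\<omega> \<in> A")
    case True
    have "(Y \<omega>)\<^sup>2 \<le> B * \<bar>Y \<omega>\<bar>"
      using mult_right_mono[OF bound[OF True], of "\<bar>Y \<omega>\<bar>"] by (simp add: power2_eq_square)
    also have "\<dots> \<le> B * (\<eta> + (B - \<eta>) * indicator G \<omega>)"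
      using bound[OF True] \<eta> that by (intro mult_left_mono) (auto simp: G_def indicator_def)
    finally show ?thesis using True by simp
  qed (use \<eta> in auto)
  have int: "integrable M (\<lambda>\<omega>. B * (\<eta> * indicator A \<omega> + (B - \<eta>) * indicator G \<omega>))"
    by (auto intro!: integrable_mult_right integrable_add simp: emeasure_eq_measure)
  have "E \<le> (\<integral>\<omega>. B * (\<eta> * indicator A \<omega> + (B - \<eta>) * indicator G \<omega>) \<partial>M)"
    unfolding E_def set_lebesgue_integral_def
  \<comment> \<open>This rule asks for integrability of the nonnegative majorant only.\<close>
  proof (rule integral_mono_AE')
    show "AE \<omega> in M. 0 \<le> B * (\<eta> * indicator A \<omega> + (B - \<eta>) * indicator G \<omega>)"
      using \<eta> by simp
  qed (use int pointwise in auto)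
  also have "\<dots> = B * (\<eta> * prob A + (B - \<eta>) * prob G)"
    by (simp add: emeasure_eq_measure)
  finally have "E / B \<le> \<eta> * prob A + (B - \<eta>) * prob G"
    using \<eta> by (simp add: field_simps)
  then have "(E / B - \<eta> * prob A) / (B - \<eta>) \<le> prob G"
    using \<eta> by (simp add: field_simps)
  moreover have "prob A * ((cond_expectation M (\<lambda>\<omega>. (Y \<omega>)\<^sup>2) A / B - \<eta>) / (B - \<eta>))
      = (E / B - \<eta> * prob A) / (B - \<eta>)"
    using pos \<eta> by (simp add: cond_expectation_def E_def field_simps)
  ultimately show ?thesis by (simp only: G_def)
qed

section \<open>Moments and truncation of a random vector\<close>

context
  fixes S :: "'a \<Rightarrow> real ^ 'n"
  assumes S [measurable]: "S \<in> borel_measurable M"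
    and int: "\<And>i j. integrable M (\<lambda>\<omega>. S \<omega> $ i * S \<omega> $ j)"
begin

lemma trunc_event_sets [measurable]: "trunc_event M S \<theta> \<in> events"
  unfolding trunc_event_def by measurable

lemma lin_comb_measurable [measurable]: "lin_comb c S \<in> borel_measurable M"
proof -
  have "lin_comb c S = (\<lambda>\<omega>. c \<bullet> S \<omega>)" by (simp add: fun_eq_iff lin_comb_eq_inner)
  then show ?thesis by simp
qed

lemma integrable_norm_square: "integrable M (\<lambda>\<omega>. (norm (S \<omega>))\<^sup>2)"
  unfolding sum_square_eq_norm[symmetric] using int by auto

lemma integrable_lin_comb_square: "integrable M (\<lambda>\<omega>. (lin_comb c S \<omega>)\<^sup>2)"
proof (rule Bochner_Integration.integrable_bound)
  show "integrable M (\<lambda>\<omega>. (norm c)\<^sup>2 * (norm (S \<omega>))\<^sup>2)"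
    using integrable_norm_square by simp
  show "AE \<omega> in M. norm ((lin_comb c S \<omega>)\<^sup>2) \<le> norm ((norm c)\<^sup>2 * (norm (S \<omega>))\<^sup>2)"
    using Cauchy_Schwarz_ineq2[of c]
    by (simp add: lin_comb_eq_inner power_mult_distrib[symmetric] abs_le_square_iff[symmetric])
qed measurable

lemma expectation_norm_square_le:
  "expectation (\<lambda>\<omega>. (norm (S \<omega>))\<^sup>2) \<le> CARD('n) * spectral_norm (second_moment M S)"
proof -
  have "expectation (\<lambda>\<omega>. (norm (S \<omega>))\<^sup>2) = (\<Sum>i\<in>UNIV. second_moment M S $ i $ i)"
    unfolding sum_square_eq_norm[symmetric] using int by (simp add: second_moment_def)
  also have "\<dots> \<le> (\<Sum>i\<in>(UNIV::'n set). spectral_norm (second_moment M S))"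
    by (intro sum_mono diagonal_le_spectral_norm)
  finally show ?thesis by simp
qed

text \<open>Otherwise the mean of the squared norm is 0, hence \<open>S\<close> vanishes almost
  surely, and so does every linear combination of its entries.\<close>

lemma spectral_norm_second_moment_pos:
  assumes nd: "non_degenerate M S"
  shows "spectral_norm (second_moment M S) > 0"
proof (rule ccontr)
  assume "\<not> ?thesis"
  then have "CARD('n) * spectral_norm (second_moment M S) \<le> 0"
    by (simp add: mult_nonneg_nonpos)
  with expectation_norm_square_le have "expectation (\<lambda>\<omega>. (norm (S \<omega>))\<^sup>2) = 0"
    by (intro antisym) auto
  then have "AE \<omega> in M. (norm (S \<omega>))\<^sup>2 = 0"
    using integral_nonneg_eq_0_iff_AE[OF integrable_norm_square] by simp
  \<comment> \<open>The all-ones vector is just a convenient nonzero witness.\<close>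
  then have "AE \<omega> in M. lin_comb 1 S \<omega> = 0"
    by eventually_elim (simp add: lin_comb_eq_inner)
  with nd show False by (auto simp: non_degenerate_def)
qed

lemma prob_trunc_event_ge:
  assumes pos: "spectral_norm (second_moment M S) > 0" and \<theta>: "\<theta> \<ge> 1"
  shows "1 - 1 / \<theta> \<le> prob (trunc_event M S \<theta>)"
proof -
  define m where "m = CARD('n) * spectral_norm (second_moment M S)"
  have m: "m > 0" using pos by (simp add: m_def)
  have "space M - trunc_event M S \<theta> = {\<omega> \<in> space M. \<not> norm (S \<omega>) \<le> \<theta> * sqrt m}"
    by (auto simp: trunc_event_def m_def)
  also have "\<dots> \<subseteq> {\<omega> \<in> space M. \<theta>\<^sup>2 * m \<le> (norm (S \<omega>))\<^sup>2}"
  proof safe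
    fix \<omega> assume "\<not> norm (S \<omega>) \<le> \<theta> * sqrt m"
    then have "(\<theta> * sqrt m)\<^sup>2 \<le> (norm (S \<omega>))\<^sup>2"
      using \<theta> m by (intro power_mono) auto
    then show "\<theta>\<^sup>2 * m \<le> (norm (S \<omega>))\<^sup>2" using m by (simp add: power_mult_distrib)
  qed
  finally have "prob (space M - trunc_event M S \<theta>) \<le> \<P>(\<omega> in M. \<theta>\<^sup>2 * m \<le> (norm (S \<omega>))\<^sup>2)"
    by (intro finite_measure_mono) auto
  also have "\<dots> \<le> expectation (\<lambda>\<omega>. (norm (S \<omega>))\<^sup>2) / (\<theta>\<^sup>2 * m)"
    using \<theta> m by (intro integral_Markov_inequality_measure[where A = "{}"] integrable_norm_square) auto
  also have "\<dots> \<le> m / (\<theta>\<^sup>2 * m)"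
    using expectation_norm_square_le \<theta> m by (intro divide_right_mono) (auto simp: m_def)
  \<comment> \<open>Markov's inequality gives 1/\<theta>^2; it is weakened to the 1/\<theta> that
    occurs in \<open>P_star\<close>.\<close>
  also have "\<dots> \<le> 1 / \<theta>"
    using \<theta> m by (simp add: field_simps power2_eq_square)
  finally show ?thesis by (simp add: prob_compl)
qed

lemma truncated_square_pos:
  assumes pos: "spectral_norm (second_moment M S) > 0"
    and nz: "\<not> (AE \<omega> in M. lin_comb c S \<omega> = 0)"
  obtains \<theta> where "\<theta> > 1" "(\<integral>\<omega>\<in>trunc_event M S \<theta>. (lin_comb c S \<omega>)\<^sup>2 \<partial>M) > 0"
proof (rule ccontr)
  assume "\<not> thesis"
  with that have npos: "\<not> (\<integral>\<omega>\<in>trunc_event M S \<theta>. (lin_comb c S \<omega>)\<^sup>2 \<partial>M) > 0"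
    if "\<theta> > 1" for \<theta> using \<open>\<theta> > 1\<close> by blast
  define r where "r = sqrt (CARD('n) * spectral_norm (second_moment M S))"
  have r: "r > 0" using pos by (simp add: r_def)
  \<comment> \<open>The levels k + 2 exceed 1 and are unbounded; being countably many, their
    exceptional null sets can be united.\<close>
  have "AE \<omega> in M. \<omega> \<in> trunc_event M S (real k + 2) \<longrightarrow> lin_comb c S \<omega> = 0" for k :: nat
  proof -
    have int': "integrable M (\<lambda>\<omega>. indicator (trunc_event M S (real k + 2)) \<omega> *\<^sub>R (lin_comb c S \<omega>)\<^sup>2)"
      by (intro integrable_mult_indicator integrable_lin_comb_square trunc_event_sets)
    have "(\<integral>\<omega>\<in>trunc_event M S (real k + 2). (lin_comb c S \<omega>)\<^sup>2 \<partial>M) = 0"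
      using npos[of "real k + 2"]
      by (intro antisym) (auto simp: set_lebesgue_integral_def not_less)
    then have "AE \<omega> in M. indicator (trunc_event M S (real k + 2)) \<omega> *\<^sub>R (lin_comb c S \<omega>)\<^sup>2 = 0"
      using integral_nonneg_eq_0_iff_AE[OF int'] by (simp add: set_lebesgue_integral_def)
    then show ?thesis by eventually_elim auto
  qed
  then have "AE \<omega> in M. \<forall>k::nat. \<omega> \<in> trunc_event M S (real k + 2) \<longrightarrow> lin_comb c S \<omega> = 0"
    by (subst AE_all_countable) blast
  then have "AE \<omega> in M. lin_comb c S \<omega> = 0"
  proof (rule AE_mp, intro AE_I2 impI)
    fix \<omega> assume \<omega>: "\<omega> \<in> space M"
      and zero: "\<forall>k::nat. \<omega> \<in> trunc_event M S (real k + 2) \<longrightarrow> lin_comb c S \<omega> = 0"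
    obtain k :: nat where "norm (S \<omega>) / r \<le> real k" using real_arch_simple by blast
    then have "norm (S \<omega>) \<le> (real k + 2) * r" using r by (simp add: field_simps)
    with \<omega> zero show "lin_comb c S \<omega> = 0" by (auto simp: trunc_event_def r_def)
  qed
  with nz show False by contradiction
qed

lemma abs_lin_comb_le_sup_bound:
  assumes "\<omega> \<in> trunc_event M S \<theta>"
  shows "\<bar>lin_comb c S \<omega>\<bar> \<le> sup_bound M S c \<theta>"
proof -
  have "\<bar>lin_comb c S \<omega>\<bar> \<le> sqrt CARD('n) * infnorm c * norm (S \<omega>)"
    by (rule abs_lin_comb_le)
  also have "\<dots> \<le> sqrt CARD('n) * infnorm c *
      (\<theta> * sqrt (CARD('n) * spectral_norm (second_moment M S)))"
    using assms by (intro mult_left_mono) (auto simp: trunc_event_def infnorm_pos_le)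
  \<comment> \<open>The factor p arises as sqrt p * sqrt p: one root from comparing
    \<open>norm\<close> with \<open>infnorm\<close>, the other from the truncation radius.\<close>
  also have "\<dots> = sup_bound M S c \<theta>"
    by (simp add: sup_bound_def real_sqrt_mult)
  finally show ?thesis .
qed

lemma P_star_bounds:
  assumes pos: "spectral_norm (second_moment M S) > 0"
    and \<theta>: "\<theta> > 1" and \<eta>: "0 < \<eta>" "\<eta> < eta_bar M S c \<theta>"
  shows "P_star M S c \<theta> \<eta> \<le> \<P>(\<omega> in M. \<bar>lin_comb c S \<omega>\<bar> > \<eta>)" "P_star M S c \<theta> \<eta> > 0"
proof -
  have \<eta>': "\<eta> < cond_ratio M S c \<theta>" "\<eta> < sup_bound M S c \<theta>"
    using \<eta> by (auto simp: eta_bar_def)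
  let ?q = "(cond_ratio M S c \<theta> - \<eta>) / (sup_bound M S c \<theta> - \<eta>)"
  have q: "?q > 0" and \<theta>': "1 - 1 / \<theta> > 0" using \<eta>' \<theta> by auto
  then show "P_star M S c \<theta> \<eta> > 0" unfolding P_star_def by (rule mult_pos_pos[rotated])
  have A: "1 - 1 / \<theta> \<le> prob (trunc_event M S \<theta>)"
    using prob_trunc_event_ge[OF pos] \<theta> by simp
  \<comment> \<open>Replacing prob by its lower bound 1 - 1/\<theta> is sound because
    \<open>?q\<close> is positive, which holds as \<eta> lies below both terms of the minimum
    \<open>eta_bar\<close>.\<close>
  have "P_star M S c \<theta> \<eta> \<le> prob (trunc_event M S \<theta>) * ?q"
    unfolding P_star_def using A q by (intro mult_right_mono) auto
  also have "\<dots> \<le> \<P>(\<omega> in M. \<bar>lin_comb c S \<omega>\<bar> > \<eta>)"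
    unfolding cond_ratio_def using A \<theta>' \<eta> \<eta>' abs_lin_comb_le_sup_bound
    by (intro prob_abs_gt_ge) auto
  finally show "P_star M S c \<theta> \<eta> \<le> \<P>(\<omega> in M. \<bar>lin_comb c S \<omega>\<bar> > \<eta>)" .
qed

text \<open>The level depends on \<open>c\<close> and the law of \<open>S\<close> alone, so one
  \<theta> serves every \<eta> and every approximating function.\<close>

lemma exists_truncation_level:
  assumes nd: "non_degenerate M S" and c: "c \<noteq> 0"
  obtains \<theta> where "\<theta> > 1" "prob (trunc_event M S \<theta>) > 0" "eta_bar M S c \<theta> > 0"
proof -
  note pos = spectral_norm_second_moment_pos[OF nd]
  obtain \<theta> where \<theta>: "\<theta> > 1" and sq: "(\<integral>\<omega>\<in>trunc_event M S \<theta>. (lin_comb c S \<omega>)\<^sup>2 \<partial>M) > 0"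
    using truncated_square_pos[OF pos] nd c unfolding non_degenerate_def by blast
  have "1 - 1 / \<theta> > 0" using \<theta> by simp
  then have A: "prob (trunc_event M S \<theta>) > 0"
    using prob_trunc_event_ge[OF pos, of \<theta>] \<theta> by linarith
  have "infnorm c > 0" using c by (simp add: infnorm_pos_lt)
  then have "sup_bound M S c \<theta> > 0" using \<theta> pos by (simp add: sup_bound_def)
  then have "eta_bar M S c \<theta> > 0"
    using A sq by (simp add: eta_bar_def cond_ratio_def cond_expectation_def)
  with \<theta> A show ?thesis by (rule that)
qed

end

end

text \<open>The first two conjuncts after \<theta> > 0 make the conditional expectation meaningful
  and the range of \<eta> nonempty, so the bounds are not vacuous.\<close>

theorem theorem2:
  fixes M :: "'w measure"
    and X :: "real \<Rightarrow> 'w \<Rightarrow> real ^ 'd"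
    and sense :: integral_sense
    and Sig :: "'d list \<Rightarrow> real \<Rightarrow> 'w \<Rightarrow> real"
    and word :: "'n::finite \<Rightarrow> 'd list"
    and S :: "'w \<Rightarrow> real ^ 'n"
    and a b C :: "real ^ 'n"
    and K :: nat and T t :: real
  assumes "prob_space M"
    and "\<And>s. s \<in> {0..T} \<Longrightarrow> X s \<in> borel_measurable M"
    and "K \<ge> 1"
    and "is_signature M sense T X K Sig"
    and "t \<in> {0..T}"
    and "bij_betw word UNIV {u. length u \<le> K}"
    and "S = sig_vector Sig word t"
    and "\<And>i j. integrable M (\<lambda>\<omega>. S \<omega> $ i * S \<omega> $ j)"
    and "non_degenerate M S"
    and "\<exists>i. a $ i \<noteq> b $ i"
    and "C = a - b"
  shows "\<exists>\<theta>>0.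
      measure M (trunc_event M S \<theta>) > 0 \<and>
      eta_bar M S C \<theta> > 0 \<and>
      (\<forall>\<eta>\<in>{0<..<eta_bar M S C \<theta>}.
         \<P>(\<omega> in M. \<bar>lin_comb a S \<omega> - lin_comb b S \<omega>\<bar> > \<eta>) \<ge> P_star M S C \<theta> \<eta> \<and>
         P_star M S C \<theta> \<eta> > 0) \<and>
      (\<forall>(f :: (real \<Rightarrow> real ^ 'd) \<Rightarrow> real) \<epsilon>.
         (\<lambda>\<omega>. f (restrict (\<lambda>s. X s \<omega>) {0..T})) \<in> borel_measurable M \<and>
         (AE \<omega> in M. \<bar>f (restrict (\<lambda>s. X s \<omega>) {0..T}) - lin_comb a S \<omega>\<bar> \<le> \<epsilon>) \<and>
         \<epsilon> < eta_bar M S C \<theta> \<longrightarrow>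
         (\<forall>\<eta>\<in>{0<..<eta_bar M S C \<theta> - \<epsilon>}.
            \<P>(\<omega> in M. \<bar>f (restrict (\<lambda>s. X s \<omega>) {0..T}) - lin_comb b S \<omega>\<bar> > \<eta>)
              \<ge> P_star M S C \<theta> (\<eta> + \<epsilon>) \<and>
            P_star M S C \<theta> (\<eta> + \<epsilon>) > 0))"
proof -
  interpret prob_space M by fact
  have "length (word i) \<le> K" for i
    using bij_betw_apply[OF \<open>bij_betw word UNIV {u. length u \<le> K}\<close>, of i] by simp
  then have S [measurable]: "S \<in> borel_measurable M"
    unfolding \<open>S = sig_vector Sig word t\<close>
    by (intro sig_vector_measurable[OF \<open>is_signature M sense T X K Sig\<close> \<open>t \<in> {0..T}\<close>])
  note int = \<open>\<And>i j. integrable M (\<lambda>\<omega>. S \<omega> $ i * S \<omega> $ j)\<close>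
  note nd = \<open>non_degenerate M S\<close>
  have "C \<noteq> 0" using \<open>\<exists>i. a $ i \<noteq> b $ i\<close> \<open>C = a - b\<close> by auto
  then obtain \<theta> where \<theta>: "\<theta> > 1" and A: "prob (trunc_event M S \<theta>) > 0"
    and \<eta>0: "eta_bar M S C \<theta> > 0"
    using exists_truncation_level[OF S int nd] by blast
  note bounds = P_star_bounds[OF S int spectral_norm_second_moment_pos[OF S int nd] \<theta>, of _ C]
  have [measurable]: "lin_comb c S \<in> borel_measurable M" for c
    by (rule lin_comb_measurable[OF S int])
  have diff: "lin_comb a S \<omega> - lin_comb b S \<omega> = lin_comb C S \<omega>" for \<omega>
    by (simp add: lin_comb_eq_inner \<open>C = a - b\<close> inner_diff_left)
  have approx: "P_star M S C \<theta> (\<eta> + \<epsilon>) \<le> \<P>(\<omega> in M. \<bar>g \<omega> - lin_comb b S \<omega>\<bar> > \<eta>)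
      \<and> P_star M S C \<theta> (\<eta> + \<epsilon>) > 0"
    if [measurable]: "g \<in> borel_measurable M" and close: "AE \<omega> in M. \<bar>g \<omega> - lin_comb a S \<omega>\<bar> \<le> \<epsilon>"
      and \<eta>: "\<eta> \<in> {0<..<eta_bar M S C \<theta> - \<epsilon>}" for g \<epsilon> \<eta>
  proof -
    \<comment> \<open>The sign of \<epsilon> is forced by the almost sure bound, since a probability
      space is not null. It ensures \<eta> + \<epsilon> > 0.\<close>
    have "AE \<omega> in M. 0 \<le> \<epsilon>" using close by eventually_elim linarith
    then have \<epsilon>: "0 \<le> \<epsilon>" by simp
    have "P_star M S C \<theta> (\<eta> + \<epsilon>) \<le> \<P>(\<omega> in M. \<bar>lin_comb C S \<omega>\<bar> > \<eta> + \<epsilon>)"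
      using \<epsilon> \<eta> by (intro bounds(1)) auto
    also have "\<dots> \<le> \<P>(\<omega> in M. \<bar>g \<omega> - lin_comb b S \<omega>\<bar> > \<eta>)"
    \<comment> \<open>Off the null set where \<open>close\<close> fails, the triangle inequality
      loses at most \<epsilon> in passing from \<open>lin_comb a S\<close> to
      \<open>g\<close>.\<close>
    proof (rule finite_measure_mono_AE)
      show "AE \<omega> in M. \<omega> \<in> {\<omega> \<in> space M. \<bar>lin_comb C S \<omega>\<bar> > \<eta> + \<epsilon>}
          \<longrightarrow> \<omega> \<in> {\<omega> \<in> space M. \<bar>g \<omega> - lin_comb b S \<omega>\<bar> > \<eta>}"
        using close by eventually_elim (auto simp: diff[symmetric])
    qed measurable
    finally show ?thesis using bounds(2)[of "\<eta> + \<epsilon>"] \<epsilon> \<eta> by auto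
  qed
  show ?thesis
  proof (rule exI[of _ \<theta>], intro conjI allI impI ballI)
    show "\<theta> > 0" using \<theta> by simp
  qed (use A \<eta>0 bounds approx in \<open>auto simp: diff\<close>)
qed

end
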